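(* For $i=1,2$ let $\sigma_i\in W^{1,\infty}(\mathbb{T}^N;\mathbb{R}^{N\times N})$ and $A_i=\sigma_i\sigma_i^T$. Assume that, for $i=1,2$, $A_i(x)\ge\nu_i(x)I$ with $\nu_i\in C(\mathbb{T}^N)$, $\nu_i\ge0$, and $$\sum_{i=1,2}\nu_i(x)>0\qquad\text{for all }x\in\mathbb{T}^N.$$ Let $C$ be a constant. If $u=(u_1,u_2)$ is a continuous viscosity subsolution of $$\begin{cases}\dfrac{\partial u_1}{\partial t}-\mathrm{trace}(A_1(x)D^2u_1)-C|Du_1|+u_1-u_2=0,& (x,t)\in\mathbb{T}^N\times(0,+\infty),\\[2mm] \dfrac{\partial u_2}{\partial t}-\mathrm{trace}(A_2(x)D^2u_2)-C|Du_2|+u_2-u_1=0,& (x,t)\in\mathbb{T}^N\times(0,+\infty),\\[2mm] u_i(x,0)=u_{0i}(x),& x\in\mathbb{T}^N,\ i=1,2,\end{cases}$$ which attains a maximum at $(\overline{x},\overline{t})\in\mathbb{T}^N\times(0,+\infty)$, then $u$ is constant.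
   Context: $\mathbb{T}^N=\mathbb{R}^N/\mathbb{Z}^N$ is the flat torus, $I$ is the identity matrix, and the initial data $u_{0i}$ are continuous on $\mathbb{T}^N$. The function $u=(u_1,u_2)$ is defined on $\mathbb{T}^N\times[0,+\infty)$. That $u$ attains a maximum at $(\overline{x},\overline{t})$ means that, for some $i\in\{1,2\}$, $u_i(\overline{x},\overline{t})=\sup_{(x,t)\in\mathbb{T}^N\times[0,+\infty),\ j=1,2}u_j(x,t)$. Viscosity subsolutions of systems are understood in the usual componentwise sense: if $u_i-\varphi$ has a local maximum at $(x,t)$, $t>0$, with $\varphi$ smooth, then the $i$th equation holds with "$\le0$" at $(x,t)$ with the derivatives of $u_i$ replaced by those of $\varphi$ and the zeroth-order terms $u_1,u_2$ evaluated at $(x,t)$.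
   Formalization: The conclusion "u is constant" is stated on T^N×[0,t̄], up to the time of the maximum; on all of T^N×[0,∞) it is false for subsolutions: with σ_i=I, u_{0i}=0, u_1=u_2=−max(0,t−1) is a subsolution attaining its maximum at t̄=1 but is not constant. *)

theory Defs
  imports "HOL-Analysis.Analysis"
begin

text \<open>
  Functions on the torus \<open>\<real>\<^sup>N/\<int>\<^sup>N\<close> are represented by their \<open>\<int>\<^sup>N\<close>-periodic lifts to
  \<open>real ^ 'n\<close>.
\<close>

definition torus_periodic :: "(real ^ 'n \<Rightarrow> 'b) \<Rightarrow> bool"
  where "torus_periodic f \<longleftrightarrow> (\<forall>x z. (\<forall>j. z $ j \<in> \<int>) \<longrightarrow> f (x + z) = f x)"

definition pd :: "'a::real_normed_vector \<Rightarrow> ('a \<Rightarrow> real) \<Rightarrow> 'a \<Rightarrow> real"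
  where "pd v f p = frechet_derivative f (at p) v"

text \<open>Both notions below are intended for open sets \<open>S\<close> only.\<close>

primrec Ck_on :: "nat \<Rightarrow> 'a::euclidean_space set \<Rightarrow> ('a \<Rightarrow> real) \<Rightarrow> bool"
  where
    "Ck_on 0 S f \<longleftrightarrow> continuous_on S f"
  | "Ck_on (Suc k) S f \<longleftrightarrow>
       (\<forall>p\<in>S. f differentiable (at p)) \<and> (\<forall>b\<in>Basis. Ck_on k S (pd b f))"

definition smooth_on :: "'a::euclidean_space set \<Rightarrow> ('a \<Rightarrow> real) \<Rightarrow> bool"
  where "smooth_on S f \<longleftrightarrow> (\<forall>k. Ck_on k S f)"

definition Linf_torus :: "(real ^ 'n \<Rightarrow> real) \<Rightarrow> bool"
  where "Linf_torus g \<longleftrightarrow>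
    torus_periodic g \<and> g \<in> borel_measurable lebesgue \<and>
    (\<exists>K. AE x in lebesgue. \<bar>g x\<bar> \<le> K)"

text \<open>\<open>g\<close> is the \<open>k\<close>-th distributional partial derivative of \<open>f\<close> on the torus; the unit cube is a
  fundamental domain, so integrals over it are integrals over the torus.\<close>

definition weak_pd_torus ::
  "'n \<Rightarrow> (real ^ 'n \<Rightarrow> real) \<Rightarrow> (real ^ 'n \<Rightarrow> real) \<Rightarrow> bool"
  where "weak_pd_torus k f g \<longleftrightarrow>
    (\<forall>\<psi>. smooth_on UNIV \<psi> \<and> torus_periodic \<psi> \<longrightarrow>
      set_lebesgue_integral lebesgue (cbox 0 1) (\<lambda>x. f x * pd (axis k 1) \<psi> x) =
      - set_lebesgue_integral lebesgue (cbox 0 1) (\<lambda>x. g x * \<psi> x))"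

text \<open>
  The Sobolev space \<open>W\<^sup>1\<^sup>,\<^sup>\<infinity>\<close> of the torus. Its elements are classes modulo null sets, each of which
  has exactly one continuous representative. Pointwise values of the coefficients always refer to
  that representative, hence the continuity requirement; together with periodicity it makes
  \<open>f\<close> itself bounded.
\<close>

definition W1inf_torus :: "(real ^ 'n \<Rightarrow> real) \<Rightarrow> bool"
  where "W1inf_torus f \<longleftrightarrow>
    torus_periodic f \<and> continuous_on UNIV f \<and>
    (\<forall>k. \<exists>g. Linf_torus g \<and> weak_pd_torus k f g)"

text \<open>The order on symmetric matrices: \<open>M \<le> M'\<close> as quadratic forms.\<close>

definition matrix_le :: "real ^ 'n ^ 'n \<Rightarrow> real ^ 'n ^ 'n \<Rightarrow> bool"
  where "matrix_le M M' \<longleftrightarrow> (\<forall>\<xi>. \<xi> \<bullet> (M *v \<xi>) \<le> \<xi> \<bullet> (M' *v \<xi>))"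

text \<open>Derivatives of a function of \<open>(x, t)\<close>.\<close>

definition time_deriv :: "((real ^ 'n) \<times> real \<Rightarrow> real) \<Rightarrow> (real ^ 'n) \<times> real \<Rightarrow> real"
  where "time_deriv \<phi> p = pd (0, 1) \<phi> p"

definition space_grad :: "((real ^ 'n) \<times> real \<Rightarrow> real) \<Rightarrow> (real ^ 'n) \<times> real \<Rightarrow> real ^ 'n"
  where "space_grad \<phi> p = (\<chi> k. pd (axis k 1, 0) \<phi> p)"

definition space_hessian :: "((real ^ 'n) \<times> real \<Rightarrow> real) \<Rightarrow> (real ^ 'n) \<times> real \<Rightarrow> real ^ 'n ^ 'n"
  where "space_hessian \<phi> p = (\<chi> j k. pd (axis j 1, 0) (pd (axis k 1, 0) \<phi>) p)"

text \<open>
  \<open>v\<close> satisfies \<open>v\<^sub>t - trace (A D\<^sup>2v) - C |Dv| + v - w \<le> 0\<close> for \<open>t > 0\<close> in the viscosity sense, where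
  \<open>w\<close> is the other component of the system. The test functions need not be periodic: only their
  behaviour near the point of maximum matters. As \<open>t > 0\<close>, the values of \<open>v\<close> at negative times
  play no role.
\<close>

definition visc_subsol_component ::
  "(real ^ 'n \<Rightarrow> real ^ 'n ^ 'n) \<Rightarrow> real \<Rightarrow>
   ((real ^ 'n) \<times> real \<Rightarrow> real) \<Rightarrow> ((real ^ 'n) \<times> real \<Rightarrow> real) \<Rightarrow> bool"
  where "visc_subsol_component A C v w \<longleftrightarrow>
    (\<forall>\<phi> x t. 0 < t \<and> smooth_on (UNIV \<times> {0<..}) \<phi> \<and>
        eventually (\<lambda>q. v q - \<phi> q \<le> v (x, t) - \<phi> (x, t)) (nhds (x, t)) \<longrightarrow>
      time_deriv \<phi> (x, t) - trace (A x ** space_hessian \<phi> (x, t))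
        - C * norm (space_grad \<phi> (x, t)) + v (x, t) - w (x, t) \<le> 0)"

text \<open>Continuous viscosity subsolutions of the initial value problem. As usual for subsolutions, the
  initial condition is required with \<open>\<le>\<close>.\<close>

definition visc_subsol_system ::
  "(2 \<Rightarrow> real ^ 'n \<Rightarrow> real ^ 'n ^ 'n) \<Rightarrow> real \<Rightarrow> (2 \<Rightarrow> real ^ 'n \<Rightarrow> real) \<Rightarrow>
   ((real ^ 'n) \<times> real \<Rightarrow> real ^ 2) \<Rightarrow> bool"
  where "visc_subsol_system A C u\<^sub>0 u \<longleftrightarrow>
    continuous_on (UNIV \<times> {0..}) u \<and>
    (\<forall>t\<ge>0. torus_periodic (\<lambda>x. u (x, t))) \<and>
    visc_subsol_component (A 1) C (\<lambda>p. u p $ 1) (\<lambda>p. u p $ 2) \<and>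
    visc_subsol_component (A 2) C (\<lambda>p. u p $ 2) (\<lambda>p. u p $ 1) \<and>
    (\<forall>i x. u (x, 0) $ i \<le> u\<^sub>0 i x)"

text \<open>The supremum is taken in the extended reals, so that it is meaningful without assuming
  boundedness of \<open>u\<close>.\<close>

definition attains_max_at :: "((real ^ 'n) \<times> real \<Rightarrow> real ^ 2) \<Rightarrow> (real ^ 'n) \<times> real \<Rightarrow> bool"
  where "attains_max_at u p \<longleftrightarrow>
    (\<exists>i. ereal (u p $ i) = (SUP (q, j)\<in>(UNIV \<times> {0..}) \<times> UNIV. ereal (u q $ j)))"

end

theory Submission
  imports Defs
begin

text \<open>
  Let \<open>M\<close> be the maximum. Wherever one component equals \<open>M\<close> at a positive time, so does the other:
  testing that component with the constant \<open>M\<close> leaves only the coupling term, \<open>u\<^sub>i - u\<^sub>j \<le> 0\<close>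
  (\<open>subsol_eq_max_imp\<close>). The two components thus have the same contact set with \<open>M\<close>, and it may be
  propagated by whichever equation happens to be nondegenerate. Near each point \<open>x\<close> one of
  \<open>\<nu>\<^sub>1\<close>, \<open>\<nu>\<^sub>2\<close> is bounded below by a positive constant, and since the other component is at most \<open>M\<close>,
  the corresponding \<open>u\<^sub>i - M\<close> is a nonpositive viscosity subsolution of a single locally uniformly
  parabolic equation.

  The strong maximum principle for such an equation is \<open>strong_maximum_principle_local\<close>: contact at
  \<open>(x\<^sub>0, t\<^sub>0)\<close> forces contact at every \<open>(y, s)\<close> with \<open>y\<close> near \<open>x\<^sub>0\<close> and \<open>s\<close> any earlier positive time.
  The usual two steps, horizontal propagation with ellipsoids and vertical propagation, are
  replaced by a single barrier. If \<open>u\<^sub>i < M\<close> at \<open>(y, s)\<close>, take a small ball around \<open>y\<close> and move it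
  at constant velocity so that its centre reaches \<open>x\<^sub>0\<close> at time \<open>t\<^sub>0\<close>. On the tube that it sweeps out,
  \<open>M\<close> minus a small multiple of an exponentially decaying bump is a strict supersolution
  (\<open>bump_barrier_strict_supersolution\<close>), hence transports the gap at time \<open>s\<close> to the point
  \<open>(x\<^sub>0, t\<^sub>0)\<close>, where there is none.

  The admissible distance from \<open>x\<^sub>0\<close> depends on \<open>x\<^sub>0\<close> but not on the times. Therefore the set of \<open>x\<close>
  such that contact holds at \<open>(x, s)\<close> for all \<open>0 < s < tbar\<close> is open; it is also closed and
  nonempty, so it is the whole space. Continuity adds the times \<open>0\<close> and \<open>tbar\<close>.
\<close>

section \<open>Calculus of smooth functions\<close>

lemma pd_eq: "(f has_derivative f') (at p) \<Longrightarrow> pd v f p = f' v"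
  unfolding pd_def by (simp add: frechet_derivative_at[symmetric])

lemma has_derivative_pd: "f differentiable (at p) \<Longrightarrow> (f has_derivative (\<lambda>v. pd v f p)) (at p)"
  unfolding pd_def by (simp add: frechet_derivative_works[symmetric])

lemma Ck_on_subset: "Ck_on k S f \<Longrightarrow> T \<subseteq> S \<Longrightarrow> Ck_on k T f"
  by (induction k arbitrary: f) (auto intro: continuous_on_subset)

lemma Ck_on_SucD: "Ck_on (Suc k) S f \<Longrightarrow> Ck_on k S f"
proof (induction k arbitrary: f)
  case 0
  then show ?case
    by (auto intro!: continuous_at_imp_continuous_on differentiable_imp_continuous_within)
next
  case (Suc k)
  then show ?case by (metis Ck_on.simps(2))
qed

lemma Ck_on_const: "Ck_on k UNIV (\<lambda>p. c)"
proof (induction k arbitrary: c)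
  case (Suc k)
  have "pd b (\<lambda>p. c) = (\<lambda>p. 0)" for b :: 'a
    by (intro ext pd_eq) (rule has_derivative_const)
  with Suc show ?case by simp
qed simp

lemma Ck_on_bounded_linear:
  assumes "bounded_linear f"
  shows "Ck_on k UNIV f"
proof (cases k)
  case 0
  then show ?thesis using assms by (simp add: linear_continuous_on)
next
  case (Suc m)
  have "pd b f = (\<lambda>p. f b)" for b
    by (intro ext pd_eq bounded_linear_imp_has_derivative assms)
  then show ?thesis using Suc assms
    by (auto simp: Ck_on_const bounded_linear_imp_differentiable)
qed

lemma Ck_on_add:
  "Ck_on k UNIV f \<Longrightarrow> Ck_on k UNIV g \<Longrightarrow> Ck_on k UNIV (\<lambda>p. f p + g p)"
proof (induction k arbitrary: f g)
  case 0
  then show ?case by (simp add: continuous_on_add)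
next
  case (Suc k)
  have "pd b (\<lambda>p. f p + g p) = (\<lambda>p. pd b f p + pd b g p)" for b
    using Suc.prems by (intro ext pd_eq has_derivative_add) (auto intro: has_derivative_pd)
  with Suc show ?case by auto
qed

text \<open>The Leibniz rule contains the undifferentiated factors, which is why the induction needs
  \<open>Ck_on_SucD\<close>; the same holds for the chain rule in \<open>Ck_on_exp\<close>.\<close>

lemma Ck_on_mult:
  "Ck_on k UNIV f \<Longrightarrow> Ck_on k UNIV g \<Longrightarrow> Ck_on k UNIV (\<lambda>p. f p * g p)"
proof (induction k arbitrary: f g)
  case 0
  then show ?case by (simp add: continuous_on_mult)
next
  case (Suc k)
  have "pd b (\<lambda>p. f p * g p) = (\<lambda>p. f p * pd b g p + pd b f p * g p)" for b
  proof
    fix p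
    have "(f has_derivative (\<lambda>v. pd v f p)) (at p)" "(g has_derivative (\<lambda>v. pd v g p)) (at p)"
      using Suc.prems by (auto intro: has_derivative_pd)
    from has_derivative_mult[OF this]
    show "pd b (\<lambda>p. f p * g p) p = f p * pd b g p + pd b f p * g p"
      by (rule pd_eq)
  qed
  moreover have "Ck_on k UNIV f" "Ck_on k UNIV g"
    using Suc.prems by (auto dest: Ck_on_SucD simp del: Ck_on.simps)
  ultimately show ?case using Suc
    by (auto intro!: Ck_on_add)
qed

lemma Ck_on_exp: "Ck_on k UNIV f \<Longrightarrow> Ck_on k UNIV (\<lambda>p. exp (f p))"
proof (induction k arbitrary: f)
  case 0
  then show ?case by (simp add: continuous_on_exp)
next
  case (Suc k)
  have der: "((\<lambda>p. exp (f p)) has_derivative (\<lambda>v. exp (f p) * pd v f p)) (at p)" for p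
  proof -
    have "(f has_derivative (\<lambda>v. pd v f p)) (at p)"
      using Suc.prems by (auto intro: has_derivative_pd)
    then show ?thesis by (auto intro!: derivative_eq_intros)
  qed
  have "pd b (\<lambda>p. exp (f p)) = (\<lambda>p. exp (f p) * pd b f p)" for b
    by (intro ext pd_eq der)
  moreover have "Ck_on k UNIV f"
    using Suc.prems by (rule Ck_on_SucD)
  ultimately show ?case using Suc der
    by (auto intro!: Ck_on_mult simp: differentiable_def)
qed

lemma Ck_on_sum:
  "finite I \<Longrightarrow> (\<And>i. i \<in> I \<Longrightarrow> Ck_on k UNIV (f i)) \<Longrightarrow> Ck_on k UNIV (\<lambda>p. \<Sum>i\<in>I. f i p)"
  by (induction I rule: finite_induct) (auto simp: Ck_on_const Ck_on_add)

section \<open>The travelling barrier\<close>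

text \<open>
  A constant minus a bump supported, at time \<open>t\<close>, in the ball of radius \<open>\<rho>\<close> around
  \<open>y + (t - s) q\<close>. The square makes the bump vanish to second order at the boundary of the ball,
  where its Hessian is then positive in the radial direction; the exponential decay makes it a
  subsolution near the centre of the ball.
\<close>

definition bump_barrier ::
  "real \<Rightarrow> real \<Rightarrow> real \<Rightarrow> real \<Rightarrow> real ^ 'n \<Rightarrow> real ^ 'n \<Rightarrow> real \<Rightarrow> (real ^ 'n) \<times> real \<Rightarrow> real"
  where "bump_barrier a \<epsilon> K \<rho> y q s p =
    a - \<epsilon> * exp (- K * (snd p - s)) *
      (\<rho>\<^sup>2 - (fst p - y - (snd p - s) *\<^sub>R q) \<bullet> (fst p - y - (snd p - s) *\<^sub>R q))\<^sup>2"

lemma smooth_bump_barrier: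
  fixes y q :: "real ^ 'n"
  shows "smooth_on S (bump_barrier a \<epsilon> K \<rho> y q s)"
proof -
  have snd: "Ck_on k UNIV (\<lambda>p::(real ^ 'n) \<times> real. snd p)" for k
    by (intro Ck_on_bounded_linear bounded_linear_snd)
  have fst: "Ck_on k UNIV (\<lambda>p::(real ^ 'n) \<times> real. fst p $ i)" for k i
    by (intro Ck_on_bounded_linear bounded_linear_compose[OF bounded_linear_vec_nth] bounded_linear_fst)
  \<comment> \<open>The barrier is rewritten as a combination of coordinates, constants and \<open>exp\<close> by sums and
    products alone.\<close>
  let ?z = "\<lambda>i p. fst p $ i + (- y $ i) + (- q $ i) * (snd p + (- s))"
  let ?\<eta> = "\<lambda>p. \<rho>\<^sup>2 + (-1) * (\<Sum>i\<in>UNIV. ?z i p * ?z i p)"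
  have "bump_barrier a \<epsilon> K \<rho> y q s =
    (\<lambda>p. a + (- \<epsilon>) * (exp ((- K) * (snd p + (- s))) * (?\<eta> p * ?\<eta> p)))"
    by (rule ext) (simp add: bump_barrier_def inner_vec_def power2_eq_square mult.assoc
        algebra_simps)
  moreover have "Ck_on k UNIV \<dots>" for k
    by (intro Ck_on_add Ck_on_mult Ck_on_exp Ck_on_sum Ck_on_const fst snd) auto
  ultimately show ?thesis
    unfolding smooth_on_def by (metis Ck_on_subset subset_UNIV)
qed

lemma bump_barrier_pd:
  fixes y q :: "real ^ 'n" and s :: real
  defines "X \<equiv> \<lambda>p. fst p - y - (snd p - s) *\<^sub>R q"
  shows "pd v (bump_barrier a \<epsilon> K \<rho> y q s) p =
    \<epsilon> * exp (- K * (snd p - s)) * (K * snd v * (\<rho>\<^sup>2 - X p \<bullet> X p)\<^sup>2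
      + 4 * (\<rho>\<^sup>2 - X p \<bullet> X p) * (X p \<bullet> (fst v - snd v *\<^sub>R q)))"
  unfolding bump_barrier_def[abs_def] X_def
  apply (rule pd_eq[THEN trans])
   apply (rule derivative_eq_intros refl)+
  apply (simp add: algebra_simps inner_commute power2_eq_square)
  done

lemma time_deriv_bump_barrier:
  fixes y q x :: "real ^ 'n" and s t :: real
  defines "X \<equiv> x - y - (t - s) *\<^sub>R q"
  shows "time_deriv (bump_barrier a \<epsilon> K \<rho> y q s) (x, t) =
    \<epsilon> * exp (- K * (t - s)) * (K * (\<rho>\<^sup>2 - X \<bullet> X)\<^sup>2 - 4 * (\<rho>\<^sup>2 - X \<bullet> X) * (X \<bullet> q))"
  by (simp add: time_deriv_def bump_barrier_pd X_def algebra_simps)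

lemma space_grad_bump_barrier:
  fixes y q x :: "real ^ 'n" and s t :: real
  defines "X \<equiv> x - y - (t - s) *\<^sub>R q"
  shows "space_grad (bump_barrier a \<epsilon> K \<rho> y q s) (x, t) =
    (4 * \<epsilon> * exp (- K * (t - s)) * (\<rho>\<^sup>2 - X \<bullet> X)) *\<^sub>R X"
  by (simp add: space_grad_def bump_barrier_pd X_def vec_eq_iff inner_axis)

lemma space_hessian_bump_barrier:
  fixes y q x :: "real ^ 'n" and s t :: real
  defines "X \<equiv> x - y - (t - s) *\<^sub>R q"
  shows "space_hessian (bump_barrier a \<epsilon> K \<rho> y q s) (x, t) $ j $ k =
    4 * \<epsilon> * exp (- K * (t - s)) * ((if j = k then \<rho>\<^sup>2 - X \<bullet> X else 0) - 2 * X $ j * X $ k)"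
proof -
  have "pd (axis k 1, 0) (bump_barrier a \<epsilon> K \<rho> y q s) =
    (\<lambda>p. 4 * \<epsilon> * exp (- K * (snd p - s)) *
       (\<rho>\<^sup>2 - (fst p - y - (snd p - s) *\<^sub>R q) \<bullet> (fst p - y - (snd p - s) *\<^sub>R q)) *
       ((fst p - y - (snd p - s) *\<^sub>R q) \<bullet> axis k 1))"
    by (rule ext) (simp add: bump_barrier_pd)
  moreover have "pd (axis j 1, 0) \<dots> (x, t) =
    4 * \<epsilon> * exp (- K * (t - s)) * ((if j = k then \<rho>\<^sup>2 - X \<bullet> X else 0) - 2 * X $ j * X $ k)"
    unfolding X_def
    apply (rule pd_eq[THEN trans])
     apply (rule derivative_eq_intros refl)+
    apply (simp add: inner_axis inner_axis' inner_axis_axis axis_nth)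
    apply (simp add: axis_def inner_commute algebra_simps)
    done
  ultimately show ?thesis by (simp add: space_hessian_def)
qed

lemma trace_hessian_bump_barrier:
  fixes y q x :: "real ^ 'n" and s t :: real
  defines "X \<equiv> x - y - (t - s) *\<^sub>R q"
  shows "trace (B ** space_hessian (bump_barrier a \<epsilon> K \<rho> y q s) (x, t)) =
    4 * \<epsilon> * exp (- K * (t - s)) * ((\<rho>\<^sup>2 - X \<bullet> X) * trace B - 2 * (X \<bullet> (B *v X)))"
proof -
  have 1: "(\<Sum>j\<in>UNIV. \<Sum>k\<in>UNIV. B $ j $ k * (if k = j then c else 0)) = c * trace B" for c
    by (simp add: trace_def sum_distrib_left mult.commute if_distrib[of "(*) _"] cong: if_cong)
  have 2: "(\<Sum>j\<in>UNIV. \<Sum>k\<in>UNIV. B $ j $ k * (2 * X $ k * X $ j)) = 2 * (X \<bullet> (B *v X))"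
    by (simp add: inner_vec_def matrix_vector_mult_def sum_distrib_left mult_ac)
  have "trace (B ** space_hessian (bump_barrier a \<epsilon> K \<rho> y q s) (x, t)) =
    (\<Sum>j\<in>UNIV. \<Sum>k\<in>UNIV. B $ j $ k * (4 * \<epsilon> * exp (- K * (t - s)) *
      ((if k = j then \<rho>\<^sup>2 - X \<bullet> X else 0) - 2 * X $ k * X $ j)))"
    unfolding X_def by (simp add: trace_def matrix_matrix_mult_def space_hessian_bump_barrier
        del: vector_minus_component vector_scaleR_component)
  also have "\<dots> = 4 * \<epsilon> * exp (- K * (t - s)) *
     ((\<Sum>j\<in>UNIV. \<Sum>k\<in>UNIV. B $ j $ k * (if k = j then \<rho>\<^sup>2 - X \<bullet> X else 0))
      - (\<Sum>j\<in>UNIV. \<Sum>k\<in>UNIV. B $ j $ k * (2 * X $ k * X $ j)))"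
    unfolding sum_distrib_left sum_subtractf[symmetric]
    by (intro sum.cong refl) (simp add: algebra_simps)
  finally show ?thesis unfolding 1 2 .
qed

text \<open>
  In terms of \<open>e = \<rho>\<^sup>2 - r\<^sup>2\<close>, with \<open>r\<close> the distance from the centre, the diffusion contributes
  \<open>8 \<nu> r\<^sup>2\<close>, the decay a multiple of \<open>e\<^sup>2\<close>, and all unfavourable terms are at most \<open>b e\<close>. The
  coefficient of \<open>e\<^sup>2\<close> is chosen so that completing the square leaves the remainder \<open>e\<^sup>2\<close>.
\<close>

lemma barrier_quadratic_pos:
  fixes \<nu> b \<rho> e :: real
  assumes "0 < \<nu>" "0 < \<rho>"
  shows "0 < 8 * \<nu> * (\<rho>\<^sup>2 - e) + (1 + (b + 8 * \<nu>)\<^sup>2 / (32 * \<nu> * \<rho>\<^sup>2)) * e\<^sup>2 - b * e"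
proof -
  define c where "c = b + 8 * \<nu>"
  define d where "d = 32 * \<nu> * \<rho>\<^sup>2"
  have d: "0 < d" using assms by (simp add: d_def)
  have "8 * \<nu> * (\<rho>\<^sup>2 - e) + (1 + c\<^sup>2 / d) * e\<^sup>2 - b * e = e\<^sup>2 + (c * e - d / 2)\<^sup>2 / d"
  proof -
    have "(c * e - d / 2)\<^sup>2 / d = c\<^sup>2 / d * e\<^sup>2 - c * e + d / 4"
      using d by (simp add: field_simps power2_eq_square)
    then show ?thesis by (simp add: c_def d_def algebra_simps)
  qed
  moreover have "0 < e\<^sup>2 + (c * e - d / 2)\<^sup>2 / d"
  proof (cases "e = 0")
    case False
    then show ?thesis using d by (simp add: add_pos_nonneg)
  qed (use d in simp)
  ultimately show ?thesis by (simp add: c_def d_def)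
qed

text \<open>
  The term on the left is the drop of the barrier below its constant. Having it
  there absorbs the zeroth-order term of the equation. The constant \<open>b\<close> collects the drift of the
  ball, the trace of the diffusion matrix and the gradient term; \<open>K\<close> exceeds the coefficient in
  \<open>barrier_quadratic_pos\<close> by one in order to pay for the drop.
\<close>

lemma bump_barrier_strict_supersolution:
  fixes B :: "real ^ 'n ^ 'n" and x y q :: "real ^ 'n" and s t :: real
  defines "X \<equiv> x - y - (t - s) *\<^sub>R q"
  assumes pos: "0 < \<nu>" "0 < \<rho>" "0 < \<epsilon>"
    and ell: "\<nu> * (norm X)\<^sup>2 \<le> X \<bullet> (B *v X)"
    and tr: "trace B \<le> \<Lambda>"
    and X: "norm X < \<rho>"
    and b: "b = 4 * (\<rho> * norm q + \<Lambda> + \<bar>C\<bar> * \<rho>)"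
    and K: "K = 2 + (b + 8 * \<nu>)\<^sup>2 / (32 * \<nu> * \<rho>\<^sup>2)"
  shows "\<epsilon> * exp (- K * (t - s)) * (\<rho>\<^sup>2 - X \<bullet> X)\<^sup>2 <
    time_deriv (bump_barrier a \<epsilon> K \<rho> y q s) (x, t)
      - trace (B ** space_hessian (bump_barrier a \<epsilon> K \<rho> y q s) (x, t))
      - C * norm (space_grad (bump_barrier a \<epsilon> K \<rho> y q s) (x, t))"
proof -
  define e where "e = \<rho>\<^sup>2 - X \<bullet> X"
  have XX: "X \<bullet> X = (norm X)\<^sup>2" by (simp add: power2_norm_eq_inner)
  have e: "0 < e"
    using X pos by (simp add: e_def XX power_strict_mono)
  define E where "E = \<epsilon> * exp (- K * (t - s))"
  have E: "0 < E" using pos by (simp add: E_def)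
  have norm_grad: "norm (space_grad (bump_barrier a \<epsilon> K \<rho> y q s) (x, t)) = E * (4 * e * norm X)"
    using e E unfolding space_grad_bump_barrier X_def[symmetric] e_def[symmetric]
    by (simp add: E_def abs_mult abs_of_pos[OF pos(3)])
  have "X \<bullet> q \<le> norm X * norm q" by (rule norm_cauchy_schwarz)
  also have "\<dots> \<le> \<rho> * norm q" using X by (intro mult_right_mono) auto
  finally have Xq: "X \<bullet> q \<le> \<rho> * norm q" .
  have "C * norm X \<le> \<bar>C\<bar> * norm X" by (intro mult_right_mono) auto
  also have "\<dots> \<le> \<bar>C\<bar> * \<rho>" using X by (intro mult_left_mono) auto
  finally have CX: "C * norm X \<le> \<bar>C\<bar> * \<rho>" .
  have "4 * (X \<bullet> q + trace B + C * norm X) * e \<le> b * e"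
    using Xq CX tr e unfolding b by (intro mult_right_mono) auto
  moreover have "8 * \<nu> * (\<rho>\<^sup>2 - e) \<le> 8 * (X \<bullet> (B *v X))"
    using ell by (simp add: e_def XX)
  moreover have "0 < 8 * \<nu> * (\<rho>\<^sup>2 - e) + (K - 1) * e\<^sup>2 - b * e"
    using barrier_quadratic_pos[OF pos(1,2), of e b] by (simp add: K)
  ultimately have "e\<^sup>2 < K * e\<^sup>2 - 4 * e * (X \<bullet> q) - 4 * (e * trace B - 2 * (X \<bullet> (B *v X)))
      - C * (4 * e * norm X)"
    by (simp add: algebra_simps)
  from mult_strict_left_mono[OF this E]
  show ?thesis
    unfolding norm_grad time_deriv_bump_barrier trace_hessian_bump_barrier
      X_def[symmetric] e_def[symmetric]
    by (simp add: E_def algebra_simps)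
qed

section \<open>Propagation of the contact set\<close>

text \<open>
  The function \<open>w\<close> enters only through its upper bound, so this is a statement about a single
  equation. If \<open>v (y, s) < M\<close>, maximise \<open>v - \<phi>\<close> over the tube, where \<open>\<phi>\<close> is the barrier. The maximum
  is positive because of the contact at \<open>(x\<^sub>0, t\<^sub>0)\<close>, whereas \<open>v \<le> \<phi>\<close> on the whole boundary of the
  tube; so it is attained in the interior, where \<open>\<phi>\<close> is an admissible test function that violates the
  subsolution property.

  The tube has to extend beyond \<open>t\<^sub>0\<close>, as the test requires a maximum in a two-sided
  neighbourhood in time. It ends at \<open>t\<^sub>0 + (t\<^sub>0 - s)\<close>; until then its centre stays within distance
  \<open>dist x\<^sub>0 y\<close> of \<open>x\<^sub>0\<close>, which accounts for the radius \<open>2 * R\<close>.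
\<close>

lemma strong_maximum_principle_local:
  fixes v w :: "(real ^ 'n) \<times> real \<Rightarrow> real"
  assumes sub: "visc_subsol_component A C v w"
    and cont: "continuous_on (UNIV \<times> {0<..}) v"
    and v_le: "\<And>x t. 0 < t \<Longrightarrow> v (x, t) \<le> M"
    and w_le: "\<And>x t. 0 < t \<Longrightarrow> w (x, t) \<le> M"
    and ell: "0 < \<nu>" "\<And>x \<xi>. x \<in> cball x\<^sub>0 (2 * R) \<Longrightarrow> \<nu> * (norm \<xi>)\<^sup>2 \<le> \<xi> \<bullet> (A x *v \<xi>)"
    and tr: "\<And>x. x \<in> cball x\<^sub>0 (2 * R) \<Longrightarrow> trace (A x) \<le> \<Lambda>"
    and max: "v (x\<^sub>0, t\<^sub>0) = M"
    and y: "dist x\<^sub>0 y < R" and s: "0 < s" "s < t\<^sub>0"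
  shows "v (y, s) = M"
proof (rule ccontr)
  assume "v (y, s) \<noteq> M"
  with v_le[OF s(1)] have less: "v (y, s) < M" by (simp add: order_less_le)
  define m where "m = (v (y, s) + M) / 2"
  have m: "v (y, s) < m" "m < M" using less by (auto simp: m_def)
  have "continuous (at (y, s)) v"
    using cont s by (auto simp: continuous_on_eq_continuous_at open_Times)
  moreover have "((\<lambda>x. (x, s)) \<longlongrightarrow> (y, s)) (at y)"
    by (intro tendsto_intros)
  ultimately have "((\<lambda>x. v (x, s)) \<longlongrightarrow> v (y, s)) (at y)"
    by (rule isCont_tendsto_compose)
  then have "eventually (\<lambda>x. v (x, s) < m) (at y)"
    using m(1) by (rule order_tendstoD)
  then obtain r where r: "0 < r" "\<And>x. x \<noteq> y \<Longrightarrow> dist x y < r \<Longrightarrow> v (x, s) < m"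
    by (auto simp: eventually_at)
  have R: "0 < R" using y by (meson le_less_trans zero_le_dist)
  define \<rho> where "\<rho> = min R (r / 2)"
  have \<rho>: "0 < \<rho>" "\<rho> \<le> R" "\<rho> < r" using r R by (auto simp: \<rho>_def)
  have bottom: "v (x, s) \<le> m" if "norm (x - y) \<le> \<rho>" for x
    using r(2)[of x] m that \<rho> by (cases "x = y") (auto simp: dist_norm)
  define d where "d = t\<^sub>0 - s"
  have d: "0 < d" using s by (simp add: d_def)
  define q where "q = (1 / d) *\<^sub>R (x\<^sub>0 - y)"
  define b where "b = 4 * (\<rho> * norm q + \<Lambda> + \<bar>C\<bar> * \<rho>)"
  define K where "K = 2 + (b + 8 * \<nu>)\<^sup>2 / (32 * \<nu> * \<rho>\<^sup>2)"
  have K: "0 < K" using ell(1) by (auto simp: K_def intro!: add_pos_nonneg)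
  \<comment> \<open>At time \<open>s\<close> the bump is at most \<open>\<rho> ^ 4\<close>, so this \<open>\<epsilon>\<close> keeps the barrier above \<open>m\<close> there.\<close>
  define \<epsilon> where "\<epsilon> = (M - m) / \<rho> ^ 4"
  have \<epsilon>: "0 < \<epsilon>" using m \<rho> by (simp add: \<epsilon>_def)
  \<comment> \<open>\<open>c\<close> is the height of the bump at the final time \<open>s + 2 * d\<close>. Raising the barrier by \<open>\<epsilon> * c\<close>
    lifts it to at least \<open>M\<close> on the top of the tube, and leaves it below \<open>M\<close> at \<open>(x\<^sub>0, t\<^sub>0)\<close>, where the
    bump has decayed for only half as long.\<close>
  define c where "c = exp (- K * (2 * d)) * \<rho> ^ 4"
  have c: "0 < c" using \<rho> by (simp add: c_def)
  define \<phi> where "\<phi> = bump_barrier (M + \<epsilon> * c) \<epsilon> K \<rho> y q s"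
  define X where "X = (\<lambda>p::(real ^ 'n) \<times> real. fst p - y - (snd p - s) *\<^sub>R q)"
  have \<phi>_eq: "\<phi> p = M - \<epsilon> * (exp (- K * (snd p - s)) * (\<rho>\<^sup>2 - (norm (X p))\<^sup>2)\<^sup>2 - c)" for p
    by (simp add: \<phi>_def bump_barrier_def X_def power2_norm_eq_inner algebra_simps)
  have \<phi>_cont: "continuous_on S \<phi>" for S
    unfolding \<phi>_def bump_barrier_def[abs_def] by (intro continuous_intros)
  have X_cont: "continuous_on S (\<lambda>p. norm (X p))" for S
    unfolding X_def by (intro continuous_intros)
  define Q where "Q = {p. snd p \<in> {s..s + 2 * d} \<and> norm (X p) \<le> \<rho>}"
  have near: "x \<in> cball x\<^sub>0 (2 * R)" if "(x, t) \<in> Q" for x t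
  proof -
    have t: "\<bar>1 - (t - s) / d\<bar> \<le> 1" using that d by (auto simp: Q_def field_simps abs_le_iff)
    have "x - x\<^sub>0 = X (x, t) - (1 - (t - s) / d) *\<^sub>R (x\<^sub>0 - y)"
      by (simp add: X_def q_def scaleR_diff_left)
    then have "norm (x - x\<^sub>0) \<le> norm (X (x, t)) + norm ((1 - (t - s) / d) *\<^sub>R (x\<^sub>0 - y))"
      by (metis norm_triangle_ineq4)
    also have "\<dots> \<le> R + 1 * norm (x\<^sub>0 - y)"
      unfolding norm_scaleR using that \<rho> t by (intro add_mono mult_right_mono) (auto simp: Q_def)
    finally show ?thesis using y by (auto simp: dist_norm norm_minus_commute)
  qed
  have "compact Q"
  proof -
    have "closed Q"
      unfolding Q_def atLeastAtMost_iff
      by (intro closed_Collect_conj closed_Collect_le X_cont continuous_intros)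
    moreover have "Q \<subseteq> cball x\<^sub>0 (2 * R) \<times> {s..s + 2 * d}"
      using near by (auto simp: Q_def)
    ultimately show ?thesis
      by (metis compact_Times compact_cball compact_Icc closed_Int_compact inf.absorb1)
  qed
  moreover have x0: "X (x\<^sub>0, t\<^sub>0) = 0"
    using d by (simp add: X_def q_def d_def)
  then have x0Q: "(x\<^sub>0, t\<^sub>0) \<in> Q" using s \<rho> by (auto simp: Q_def d_def)
  moreover have "continuous_on Q (\<lambda>p. v p - \<phi> p)"
    using s by (intro continuous_intros \<phi>_cont continuous_on_subset[OF cont]) (auto simp: Q_def)
  ultimately obtain p where p: "p \<in> Q" "\<And>p'. p' \<in> Q \<Longrightarrow> v p' - \<phi> p' \<le> v p - \<phi> p"
    using continuous_attains_sup[of Q "\<lambda>p. v p - \<phi> p"] by blast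
  obtain x t where [simp]: "p = (x, t)" by (cases p)
  have t: "s \<le> t" "t \<le> s + 2 * d" and Xp: "norm (X (x, t)) \<le> \<rho>"
    using p(1) by (auto simp: Q_def)
  have "0 < v (x\<^sub>0, t\<^sub>0) - \<phi> (x\<^sub>0, t\<^sub>0)"
  proof -
    have "c < exp (- K * (t\<^sub>0 - s)) * \<rho> ^ 4"
      unfolding c_def using K d \<rho> by (intro mult_strict_right_mono) (auto simp: d_def)
    then show ?thesis using \<epsilon> by (simp add: \<phi>_eq x0 max)
  qed
  with p(2)[OF x0Q] have pos: "\<phi> (x, t) < v (x, t)" by simp
  have vM: "v (x, t) \<le> M" using t s by (intro v_le) auto
  have sq: "(\<rho>\<^sup>2 - (norm (X (x, t)))\<^sup>2)\<^sup>2 \<le> \<rho> ^ 4"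
  proof -
    have "(norm (X (x, t)))\<^sup>2 \<le> \<rho>\<^sup>2" using Xp by (intro power_mono) auto
    then have "(\<rho>\<^sup>2 - (norm (X (x, t)))\<^sup>2)\<^sup>2 \<le> (\<rho>\<^sup>2)\<^sup>2"
      by (intro power_mono) auto
    then show ?thesis by simp
  qed
  have "norm (X (x, t)) \<noteq> \<rho>"
  proof
    assume "norm (X (x, t)) = \<rho>"
    then have "\<phi> (x, t) = M + \<epsilon> * c" by (simp add: \<phi>_eq)
    then show False using pos vM mult_pos_pos[OF \<epsilon> c] by linarith
  qed
  with Xp have X_less: "norm (X (x, t)) < \<rho>" by simp
  have "t \<noteq> s"
  proof
    assume ts: "t = s"
    have "M - \<epsilon> * \<rho> ^ 4 \<le> M - \<epsilon> * ((\<rho>\<^sup>2 - (norm (X (x, t)))\<^sup>2)\<^sup>2 - c)"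
      using sq c \<epsilon> by (intro diff_left_mono mult_left_mono) auto
    also have "\<dots> = \<phi> (x, t)" by (simp add: \<phi>_eq ts)
    finally have "m \<le> \<phi> (x, t)" using \<rho> by (simp add: \<epsilon>_def)
    moreover have "v (x, t) \<le> m"
      using bottom[of x] Xp by (simp add: ts X_def)
    ultimately show False using pos by simp
  qed
  moreover have "t \<noteq> s + 2 * d"
  proof
    assume "t = s + 2 * d"
    then have "exp (- K * (t - s)) * (\<rho>\<^sup>2 - (norm (X (x, t)))\<^sup>2)\<^sup>2 \<le> c"
      unfolding c_def using sq by (intro mult_mono) auto
    then have "M \<le> \<phi> (x, t)" using \<epsilon> by (simp add: \<phi>_eq mult_nonneg_nonpos)
    then show False using pos vM by simp
  qed
  ultimately have t_less: "s < t" "t < s + 2 * d" using t by auto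
  have "open {p. s < snd p \<and> snd p < s + 2 * d \<and> norm (X p) < \<rho>}"
    by (intro open_Collect_conj open_Collect_less X_cont continuous_intros)
  then have "eventually (\<lambda>p. p \<in> {p. s < snd p \<and> snd p < s + 2 * d \<and> norm (X p) < \<rho>}) (nhds (x, t))"
    using t_less X_less by (intro eventually_nhds_in_open) auto
  then have "eventually (\<lambda>p. v p - \<phi> p \<le> v (x, t) - \<phi> (x, t)) (nhds (x, t))"
    by (rule eventually_mono) (use p in \<open>auto simp: Q_def\<close>)
  moreover have "0 < t" using t s by simp
  ultimately have "time_deriv \<phi> (x, t) - trace (A x ** space_hessian \<phi> (x, t))
        - C * norm (space_grad \<phi> (x, t)) + v (x, t) - w (x, t) \<le> 0"
    using sub smooth_bump_barrier unfolding visc_subsol_component_def \<phi>_def by blast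
  moreover have "w (x, t) \<le> M" using \<open>0 < t\<close> by (rule w_le)
  moreover have "\<epsilon> * exp (- K * (t - s)) * (\<rho>\<^sup>2 - X (x, t) \<bullet> X (x, t))\<^sup>2 <
      time_deriv \<phi> (x, t) - trace (A x ** space_hessian \<phi> (x, t)) - C * norm (space_grad \<phi> (x, t))"
  proof -
    have "x \<in> cball x\<^sub>0 (2 * R)" using near p(1) by simp
    then show ?thesis
      using bump_barrier_strict_supersolution[OF ell(1) \<rho>(1) \<epsilon> _ _ _ b_def K_def, of x y t s "A x"]
        ell(2) tr X_less
      unfolding \<phi>_def X_def by simp
  qed
  moreover have "M - \<epsilon> * exp (- K * (t - s)) * (\<rho>\<^sup>2 - X (x, t) \<bullet> X (x, t))\<^sup>2 \<le> \<phi> (x, t)"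
    using mult_pos_pos[OF \<epsilon> c] by (simp add: \<phi>_eq power2_norm_eq_inner algebra_simps)
  ultimately show False using pos by linarith
qed

section \<open>The coefficients and the coupling\<close>

lemma continuous_on_trace_mult_transpose:
  fixes \<sigma> :: "'a::topological_space \<Rightarrow> real ^ 'n ^ 'm"
  assumes "\<And>j k. continuous_on S (\<lambda>x. \<sigma> x $ j $ k)"
  shows "continuous_on S (\<lambda>x. trace (\<sigma> x ** transpose (\<sigma> x)))"
  unfolding trace_def matrix_matrix_mult_def transpose_def
  by (simp only: vec_lambda_beta) (intro continuous_on_sum continuous_on_mult' assms)

text \<open>At a contact point the constant \<open>M\<close> touches \<open>v\<close> from above; all its derivatives vanish, so the
  equation reduces to \<open>v - w \<le> 0\<close>.\<close>

lemma subsol_eq_max_imp: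
  fixes v w :: "(real ^ 'n) \<times> real \<Rightarrow> real"
  assumes sub: "visc_subsol_component A C v w"
    and v_le: "\<And>x t. 0 < t \<Longrightarrow> v (x, t) \<le> M"
    and w_le: "\<And>x t. 0 < t \<Longrightarrow> w (x, t) \<le> M"
    and t: "0 < t" and max: "v (x, t) = M"
  shows "w (x, t) = M"
proof -
  have pd0: "pd b (\<lambda>p. M) = (\<lambda>p. 0)" for b :: "(real ^ 'n) \<times> real" and M :: real
    by (intro ext pd_eq) (rule has_derivative_const)
  have "open (UNIV \<times> {0<..} :: ((real ^ 'n) \<times> real) set)"
    by (intro open_Times) auto
  then have "eventually (\<lambda>p. p \<in> UNIV \<times> {0<..}) (nhds (x, t))"
    using t by (intro eventually_nhds_in_open) auto
  then have "eventually (\<lambda>p. v p - M \<le> v (x, t) - M) (nhds (x, t))"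
    by (rule eventually_mono) (use v_le max in auto)
  moreover have "smooth_on (UNIV \<times> {0<..}) (\<lambda>p::(real ^ 'n) \<times> real. M)"
    unfolding smooth_on_def by (metis Ck_on_subset Ck_on_const subset_UNIV)
  ultimately have "time_deriv (\<lambda>p. M) (x, t) - trace (A x ** space_hessian (\<lambda>p. M) (x, t))
        - C * norm (space_grad (\<lambda>p. M) (x, t)) + v (x, t) - w (x, t) \<le> 0"
    using sub t unfolding visc_subsol_component_def by blast
  then have "v (x, t) \<le> w (x, t)"
    by (simp add: time_deriv_def space_hessian_def space_grad_def pd0 trace_def
        matrix_matrix_mult_def norm_vec_def L2_set_def)
  with w_le[OF t, of x] max show ?thesis by simp
qed

section \<open>The strong maximum principle for the system\<close>

theorem theorem3p4:
  fixes \<sigma> :: "2 \<Rightarrow> real ^ 'n \<Rightarrow> real ^ 'n ^ 'n"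
    and A :: "2 \<Rightarrow> real ^ 'n \<Rightarrow> real ^ 'n ^ 'n"
    and \<nu> :: "2 \<Rightarrow> real ^ 'n \<Rightarrow> real"
    and C :: real
    and u\<^sub>0 :: "2 \<Rightarrow> real ^ 'n \<Rightarrow> real"
    and u :: "(real ^ 'n) \<times> real \<Rightarrow> real ^ 2"
    and xbar :: "real ^ 'n" and tbar :: real
  assumes \<sigma>: "\<And>i j k. W1inf_torus (\<lambda>x. \<sigma> i x $ j $ k)"
    and A: "\<And>i x. A i x = \<sigma> i x ** transpose (\<sigma> i x)"
    and \<nu>_cont: "\<And>i. continuous_on UNIV (\<nu> i)" "\<And>i. torus_periodic (\<nu> i)"
    and \<nu>_nonneg: "\<And>i x. 0 \<le> \<nu> i x"
    and ellipticity: "\<And>i x. matrix_le (\<nu> i x *\<^sub>R mat 1) (A i x)"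
    and \<nu>_sum: "\<And>x. 0 < (\<Sum>i\<in>UNIV. \<nu> i x)"
    and u\<^sub>0: "\<And>i. continuous_on UNIV (u\<^sub>0 i)" "\<And>i. torus_periodic (u\<^sub>0 i)"
    and subsol: "visc_subsol_system A C u\<^sub>0 u"
    and tbar: "0 < tbar"
    and max: "attains_max_at u (xbar, tbar)"
  shows "u constant_on (UNIV \<times> {0..tbar})"
proof -
  have u_cont: "continuous_on (UNIV \<times> {0..}) u"
    and sub1: "visc_subsol_component (A 1) C (\<lambda>p. u p $ 1) (\<lambda>p. u p $ 2)"
    and sub2: "visc_subsol_component (A 2) C (\<lambda>p. u p $ 2) (\<lambda>p. u p $ 1)"
    using subsol by (auto simp: visc_subsol_system_def)
  obtain i\<^sub>0 where i0: "ereal (u (xbar, tbar) $ i\<^sub>0) = (SUP (q, j)\<in>(UNIV \<times> {0..}) \<times> UNIV. ereal (u q $ j))"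
    using max by (auto simp: attains_max_at_def)
  define M where "M = u (xbar, tbar) $ i\<^sub>0"
  have le: "u (x, t) $ j \<le> M" if "0 < t" for x t j
  proof -
    have "ereal (u (x, t) $ j) \<le> (SUP (q, j)\<in>(UNIV \<times> {0..}) \<times> UNIV. ereal (u q $ j))"
      using that by (intro SUP_upper2[of "((x, t), j)"]) auto
    then show ?thesis by (simp add: i0[symmetric] M_def)
  qed
  have contact: "u (x, t) $ j = M" if "0 < t" "u (x, t) $ i = M" for x t i j
    using subsol_eq_max_imp[OF sub1 le le that(1), of x]
      subsol_eq_max_imp[OF sub2 le le that(1), of x] that(2) exhaust_2[of i] exhaust_2[of j]
    by auto
  have comp_cont: "continuous_on (UNIV \<times> {0<..}) (\<lambda>p. u p $ i)" for i
    by (intro continuous_intros continuous_on_subset[OF u_cont]) auto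
  have sub: "\<exists>j. visc_subsol_component (A i) C (\<lambda>p. u p $ i) (\<lambda>p. u p $ j)" for i
    using exhaust_2[of i] sub1 sub2 by auto
  \<comment> \<open>The component \<open>i\<close> used for the propagation depends on \<open>x\<close>; by \<open>contact\<close> the conclusion can
    always be phrased with the first one, so that the steps can be chained.\<close>
  have spread: "\<exists>R>0. \<forall>t y s. u (x, t) $ 1 = M \<and> dist x y < R \<and> 0 < s \<and> s < t \<longrightarrow> u (y, s) $ 1 = M" for x
  proof -
    obtain i where i: "0 < \<nu> i x"
      using \<nu>_sum[of x] \<nu>_nonneg by (meson linorder_not_le sum_nonpos)
    have "isCont (\<nu> i) x"
      using \<nu>_cont(1) by (simp add: continuous_on_eq_continuous_at)
    then have "(\<nu> i \<longlongrightarrow> \<nu> i x) (at x)" by (simp add: isCont_def)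
    then have "eventually (\<lambda>y. \<nu> i x / 2 < \<nu> i y) (at x)"
      by (rule order_tendstoD) (use i in simp)
    then obtain r where r: "0 < r" "\<And>y. y \<noteq> x \<Longrightarrow> dist y x < r \<Longrightarrow> \<nu> i x / 2 < \<nu> i y"
      by (auto simp: eventually_at)
    define R where "R = r / 4"
    have R: "0 < R" using r by (simp add: R_def)
    have \<nu>_ge: "\<nu> i x / 2 \<le> \<nu> i y" if "y \<in> cball x (2 * R)" for y
      using r(2)[of y] r(1) i that by (cases "y = x") (auto simp: R_def dist_commute)
    have ell: "\<nu> i x / 2 * (norm \<xi>)\<^sup>2 \<le> \<xi> \<bullet> (A i y *v \<xi>)" if "y \<in> cball x (2 * R)" for y \<xi>
    proof -
      have "\<nu> i x / 2 * (norm \<xi>)\<^sup>2 \<le> \<nu> i y * (norm \<xi>)\<^sup>2"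
        by (intro mult_right_mono \<nu>_ge that) auto
      also have "\<dots> \<le> \<xi> \<bullet> (A i y *v \<xi>)"
        using ellipticity[of i y] unfolding matrix_le_def
        by (simp add: scaleR_matrix_vector_assoc[symmetric] power2_norm_eq_inner)
      finally show ?thesis .
    qed
    have "continuous_on (cball x (2 * R)) (\<lambda>y. trace (A i y))"
      unfolding A using \<sigma>
      by (intro continuous_on_trace_mult_transpose)
        (auto simp: W1inf_torus_def intro: continuous_on_subset)
    moreover have "cball x (2 * R) \<noteq> {}" using R by simp
    ultimately have "\<exists>z\<in>cball x (2 * R). \<forall>y\<in>cball x (2 * R). trace (A i y) \<le> trace (A i z)"
      by (intro continuous_attains_sup compact_cball)
    then obtain z where tr: "\<And>y. y \<in> cball x (2 * R) \<Longrightarrow> trace (A i y) \<le> trace (A i z)"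
      by blast
    obtain j where j: "visc_subsol_component (A i) C (\<lambda>p. u p $ i) (\<lambda>p. u p $ j)"
      using sub by blast
    have "u (y, s) $ 1 = M" if "u (x, t) $ 1 = M" "dist x y < R" "0 < s" "s < t" for t y s
    proof -
      have "u (y, s) $ i = M"
      proof (rule strong_maximum_principle_local[OF j comp_cont])
        show "0 < \<nu> i x / 2" using i by simp
        show "u (x, t) $ i = M" using contact[of t x 1 i] that by simp
        show "dist x y < R" "0 < s" "s < t" by (rule that)+
        show "trace (A i x') \<le> trace (A i z)" if "x' \<in> cball x (2 * R)" for x'
          using that by (rule tr)
      qed (simp_all only: le ell)
      then show ?thesis using contact[of s y i 1] that(3) by simp
    qed
    then show ?thesis using R by blast
  qed
  define S where "S = {x. \<forall>s\<in>{0<..<tbar}. u (x, s) $ 1 = M}"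
  have "u (xbar, tbar) $ 1 = M"
    using contact[of tbar xbar i\<^sub>0 1] tbar by (simp add: M_def)
  moreover obtain R where "0 < R"
      "\<And>t y s. u (xbar, t) $ 1 = M \<Longrightarrow> dist xbar y < R \<Longrightarrow> 0 < s \<Longrightarrow> s < t \<Longrightarrow> u (y, s) $ 1 = M"
    using spread[of xbar] by blast
  ultimately have "xbar \<in> S" by (simp add: S_def)
  moreover have "open S"
  proof (rule openI)
    fix x assume x: "x \<in> S"
    obtain R where R: "0 < R"
      "\<And>t y s. u (x, t) $ 1 = M \<Longrightarrow> dist x y < R \<Longrightarrow> 0 < s \<Longrightarrow> s < t \<Longrightarrow> u (y, s) $ 1 = M"
      using spread[of x] by blast
    have "ball x R \<subseteq> S"
    proof
      fix y assume y: "y \<in> ball x R"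
      have "u (y, s) $ 1 = M" if s: "s \<in> {0<..<tbar}" for s
      proof -
        \<comment> \<open>Propagation goes strictly backwards in time, hence the detour through a later time \<open>t\<close>.\<close>
        obtain t where "s < t" "t < tbar" using s dense[of s tbar] by auto
        then show ?thesis using R(2)[of t y s] x y s by (auto simp: S_def)
      qed
      then show "y \<in> S" by (simp add: S_def)
    qed
    then show "\<exists>e>0. ball x e \<subseteq> S" using R(1) by blast
  qed
  moreover have "closed S"
  proof -
    have "closed {x. u (x, s) $ 1 = M}" if "s \<in> {0<..<tbar}" for s
      using that
      by (intro closed_Collect_eq continuous_intros continuous_on_compose2[OF u_cont]) auto
    moreover have "S = (\<Inter>s\<in>{0<..<tbar}. {x. u (x, s) $ 1 = M})" by (auto simp: S_def)
    ultimately show ?thesis by auto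
  qed
  ultimately have "S = UNIV"
    using clopen[of S] by auto
  then have open_time: "u (x, s) = (\<chi> i. M)" if "s \<in> {0<..<tbar}" for x s
  proof -
    have "x \<in> S" using \<open>S = UNIV\<close> by simp
    then have "u (x, s) $ 1 = M" using that by (simp add: S_def)
    then show ?thesis using contact[of s x 1] that by (simp add: vec_eq_iff)
  qed
  have "u (x, s) = (\<chi> i. M)" if "s \<in> {0..tbar}" for x s
  proof -
    have "continuous_on {0..tbar} (\<lambda>s. u (x, s))"
      by (rule continuous_on_compose2[OF u_cont]) (auto intro!: continuous_intros)
    moreover have "{0..tbar} = closure {0<..<tbar}" using tbar by simp
    ultimately have closure: "continuous_on (closure {0<..<tbar}) (\<lambda>s. u (x, s))"
      "s \<in> closure {0<..<tbar}" using that by simp_all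
    show ?thesis
      by (rule continuous_constant_on_closure[OF closure(1) _ closure(2)]) (rule open_time)
  qed
  then show ?thesis by (auto simp: constant_on_def)
qed

end
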